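(* Let $\psi_n$ and $\Psi_n$ be defined as in the context. For every $n \geq 1$ and $1 \leq k \leq n$, \[ \|\psi_n\| = n,\qquad \|\Psi_n\| \leq n,\qquad \|B_{n,k}(\psi_1,\ldots,\psi_{n-k+1})\| \leq n . \] Moreover $B_{n,n}(\psi_1) = x_1^n$, so $\|B_{n,n}(\psi_1)\| = n$. Furthermore, for $n \geq 2$, the coefficient of the monomial $x_1$ in $\psi_n$ is $n!$ and the coefficient of the monomial $x_n$ in $\psi_n$ is $(-1)^{n-1}(n-1)!$.
   Context: For a monomial $x_{\gamma_1}x_{\gamma_2}\cdots x_{\gamma_\ell}$ (indices with repetition, i.e. a partition $\gamma$) its partition order is $\gamma_1+\cdots+\gamma_\ell$. For a nonzero polynomial $f \in \mathbb{Z}[x_1,x_2,\ldots]$, $\|f\|$ is the maximum partition order of the monomials occurring in $f$ with nonzero coefficient, and $\|0\| = 0$. Partial Bell polynomials: $B_{N,k}(y_1,\ldots,y_{N-k+1}) = \sum \frac{N!}{j_1!\cdots j_{N-k+1}!}\prod_{i}(y_i/i!)^{j_i}$ over nonnegative integers $j_i$ with $\sum_i i j_i = N$, $\sum_i j_i = k$; $B_N = \sum_{k=1}^N B_{N,k}$. $\sigma^\star_n = (-1)^n B_n(-x_1,-1!\,x_2,\ldots,-(n-1)!\,x_n)$. Stirling numbers of the first kind $S_1(N,k)$ are defined by $x(x-1)\cdots(x-N+1) = \sum_k S_1(N,k)x^k$, and $(n)_k = n!/(n-k)!$. Define $\psi_0 = 0$ and for $n \geq 1$ \[ \psi_n = n\,\psi_{n-1}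 + \sigma^\star_n + \Psi_n,\qquad \Psi_n = \sum_{\nu=2}^{n}\sum_{k=0}^{\min(\nu,n-\nu)} (-1)^{\nu+1} S_1(\nu+1,k+1)\,(n)_k\, B_{n-k,\nu}(\psi_1,\ldots,\psi_{n-k-\nu+1}). \] *)

theory Defs
  imports
    Complex_Main
    "HOL-Library.Poly_Mapping"
    "HOL-Computational_Algebra.Polynomial"
begin

text \<open>
  A monomial is its exponent vector. The index 0 does not occur in the ring with variables
  \<open>x\<^sub>1, x\<^sub>2, \<dots>\<close>; every polynomial defined below uses indices \<open>\<ge> 1\<close> only.
\<close>

type_synonym mpoly_int = "(nat \<Rightarrow>\<^sub>0 nat) \<Rightarrow>\<^sub>0 int"

definition X :: "nat \<Rightarrow> mpoly_int" where
  "X i = Poly_Mapping.single (Poly_Mapping.single i 1) 1"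

definition partition_order :: "(nat \<Rightarrow>\<^sub>0 nat) \<Rightarrow> nat" where
  "partition_order m = (\<Sum>i\<in>Poly_Mapping.keys m. i * Poly_Mapping.lookup m i)"

definition pnorm :: "mpoly_int \<Rightarrow> nat" where
  "pnorm f = (if f = 0 then 0 else Max (partition_order ` Poly_Mapping.keys f))"

definition bell_index :: "nat \<Rightarrow> nat \<Rightarrow> (nat \<Rightarrow> nat) set" where
  "bell_index N k = {j. (\<forall>i. i \<notin> {1..N - k + 1} \<longrightarrow> j i = 0) \<and>
      (\<Sum>i=1..N - k + 1. i * j i) = N \<and> (\<Sum>i=1..N - k + 1. j i) = k}"

text \<open>
  The numerical factors are collected into one natural number, so that the polynomials can be
  evaluated in any commutative ring. The division is exact (\<open>bell_coeff_exact\<close> below), and over a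
  field of characteristic 0 one obtains the usual formula (\<open>bell_partial_field\<close> below).
\<close>

definition bell_partial :: "nat \<Rightarrow> nat \<Rightarrow> (nat \<Rightarrow> 'a::comm_ring_1) \<Rightarrow> 'a" where
  "bell_partial N k y = (\<Sum>j\<in>bell_index N k.
      of_nat (fact N div (\<Prod>i=1..N - k + 1. fact (j i) * fact i ^ j i)) *
      (\<Prod>i=1..N - k + 1. y i ^ j i))"

definition bell_complete :: "nat \<Rightarrow> (nat \<Rightarrow> 'a::comm_ring_1) \<Rightarrow> 'a" where
  "bell_complete N y = (\<Sum>k=1..N. bell_partial N k y)"

lemma finite_bell_index: "finite (bell_index N k)"
proof -
  have "j i \<le> k" if "j \<in> bell_index N k" "i \<in> {1..N - k + 1}" for j i
    using that member_le_sum[of i "{1..N - k + 1}" j] by (auto simp: bell_index_def)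
  then have "bell_index N k \<subseteq>
      {j. \<forall>i. (i \<in> {1..N - k + 1} \<longrightarrow> j i \<in> {0..k}) \<and> (i \<notin> {1..N - k + 1} \<longrightarrow> j i = 0)}"
    by (auto simp: bell_index_def)
  then show ?thesis
    by (rule finite_subset) (rule finite_set_of_finite_funs, auto)
qed

lemma fact_mult_power_dvd_fact:
  assumes "i \<ge> 1"
  shows "fact j * fact i ^ j dvd (fact (i * j) :: nat)"
proof (induction j)
  case (Suc j)
  obtain p where p: "i = Suc p" using assms by (cases i) auto
  define n where "n = i * Suc j"
  have n: "n = Suc (n - 1)" by (simp add: n_def p)
  have "Suc p * (n choose i) = Suc p * (Suc j * ((n - 1) choose p))"
    using Suc_times_binomial[of p "n - 1"] n unfolding p by (simp add: n_def p algebra_simps)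
  then have c: "n choose i = Suc j * ((n - 1) choose p)"
    by (simp only: mult_cancel1) simp
  have "fact n = fact i * fact (i * j) * (n choose i)"
    using binomial_fact_lemma[of i n] by (simp add: n_def)
  also have "\<dots> = (Suc j * fact i) * fact (i * j) * ((n - 1) choose p)"
    by (simp only: c mult_ac)
  finally have f: "fact n = (Suc j * fact i) * fact (i * j) * ((n - 1) choose p)" .
  have "fact (Suc j) * fact i ^ Suc j = (Suc j * fact i) * (fact j * fact i ^ j :: nat)"
    by (simp add: algebra_simps)
  also have "\<dots> dvd (Suc j * fact i) * fact (i * j)"
    using Suc.IH by (intro mult_dvd_mono) auto
  also have "\<dots> dvd fact n" unfolding f by simp
  finally show ?case by (simp add: n_def)
qed simp

lemma bell_coeff_exact:
  assumes "j \<in> bell_index N k"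
  shows "(\<Prod>i=1..N - k + 1. fact (j i) * fact i ^ j i) dvd (fact N :: nat)"
proof -
  have "(\<Prod>i\<in>A. fact (j i) * fact i ^ j i) dvd (fact (\<Sum>i\<in>A. i * j i) :: nat)"
    if "finite A" "\<forall>i\<in>A. i \<ge> 1" for A
    using that
  proof (induction A rule: finite_induct)
    case (insert a A)
    have "(\<Prod>i\<in>insert a A. fact (j i) * fact i ^ j i) dvd
        (fact (a * j a) * fact (\<Sum>i\<in>A. i * j i) :: nat)"
      using insert by (simp, intro mult_dvd_mono fact_mult_power_dvd_fact) auto
    also have "\<dots> dvd fact (a * j a + (\<Sum>i\<in>A. i * j i))"
      by (rule fact_fact_dvd_fact)
    finally show ?case using insert by simp
  qed simp
  from this[of "{1..N - k + 1}"] show ?thesis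
    using assms by (simp add: bell_index_def)
qed

lemma bell_partial_field:
  fixes y :: "nat \<Rightarrow> 'a::field_char_0"
  shows "bell_partial N k y = (\<Sum>j\<in>bell_index N k.
    fact N / (\<Prod>i=1..N - k + 1. fact (j i)) * (\<Prod>i=1..N - k + 1. (y i / fact i) ^ j i))"
  unfolding bell_partial_def
proof (rule sum.cong[OF refl])
  fix j assume "j \<in> bell_index N k"
  note d = bell_coeff_exact[OF this]
  show "of_nat (fact N div (\<Prod>i=1..N - k + 1. fact (j i) * fact i ^ j i)) *
      (\<Prod>i=1..N - k + 1. y i ^ j i) =
      fact N / (\<Prod>i=1..N - k + 1. fact (j i)) * (\<Prod>i=1..N - k + 1. (y i / fact i) ^ j i)"
    unfolding of_nat_of_nat_div[OF d]
    by (simp add: field_simps power_divide prod_dividef prod.distrib of_nat_prod del: prod.cl_ivl_Suc)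
qed

lemma bell_partial_cong:
  assumes "\<And>i. 1 \<le> i \<Longrightarrow> i \<le> N - k + 1 \<Longrightarrow> y i = z i"
  shows "bell_partial N k y = bell_partial N k z"
  unfolding bell_partial_def using assms by (intro sum.cong prod.cong arg_cong2[of _ _ _ _ "(*)"]) auto

definition sigma_star :: "nat \<Rightarrow> mpoly_int" where
  "sigma_star n = (-1) ^ n * bell_complete n (\<lambda>i. - (of_nat (fact (i - 1)) * X i))"

text \<open>Signed, unlike \<open>stirling\<close> in \<open>HOL-Combinatorics.Stirling\<close>.\<close>

definition S1 :: "nat \<Rightarrow> nat \<Rightarrow> int" where
  "S1 N k = coeff (\<Prod>i<N. [:- of_nat i, 1:]) k"

text \<open>
  \<open>\<Psi>\<^sub>n\<close> with an arbitrary sequence in place of \<open>\<psi>\<close>, which breaks the mutual recursion between \<open>\<psi>\<close>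
  and \<open>\<Psi>\<close>; the recursion in its usual form is \<open>psi_rec\<close> below. The factor \<open>fact n div fact (n - k)\<close>
  is an exact division.
\<close>

definition Psi_sum :: "(nat \<Rightarrow> mpoly_int) \<Rightarrow> nat \<Rightarrow> mpoly_int" where
  "Psi_sum y n = (\<Sum>\<nu>=2..n. \<Sum>k=0..min \<nu> (n - \<nu>).
      (-1) ^ (\<nu> + 1) * of_int (S1 (\<nu> + 1) (k + 1)) * of_nat (fact n div fact (n - k)) *
      bell_partial (n - k) \<nu> y)"

lemma Psi_sum_cong [fundef_cong]:
  assumes "n = m" and "\<And>i. i < m \<Longrightarrow> y i = z i"
  shows "Psi_sum y n = Psi_sum z m"
  unfolding Psi_sum_def assms(1)
  by (intro sum.cong refl arg_cong2[of _ _ _ _ "(*)"] bell_partial_cong assms(2)) auto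

fun psi :: "nat \<Rightarrow> mpoly_int" where
  "psi 0 = 0"
| "psi (Suc m) = of_nat (Suc m) * psi m + sigma_star (Suc m) + Psi_sum psi (Suc m)"

definition Psi :: "nat \<Rightarrow> mpoly_int" where
  "Psi n = Psi_sum psi n"

lemma psi_rec: "n \<ge> 1 \<Longrightarrow> psi n = of_nat n * psi (n - 1) + sigma_star n + Psi n"
  by (cases n) (simp_all add: Psi_def)

end

theory Submission
  imports Defs
begin

text \<open>
  Grade monomials by partition order and by total degree. A Bell polynomial \<open>B\<^sub>N\<^sub>,\<^sub>k\<close> in
  arguments \<open>y\<^sub>i\<close> of partition order at most \<open>i\<close> has partition order at most \<open>N\<close>, which
  bounds everything from above by induction. If the \<open>y\<^sub>i\<close> have no constant term, then
  \<open>B\<^sub>N\<^sub>,\<^sub>k\<close> has no monomial of total degree less than \<open>k\<close>. Hence \<open>\<Psi>\<^sub>n\<close>, which only involves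
  \<open>k \<ge> 2\<close>, contributes no linear monomial, and \<open>\<sigma>\<^sup>\<star>\<^sub>n\<close> contributes only the one from
  \<open>B\<^sub>n\<^sub>,\<^sub>1(y) = y\<^sub>n\<close>. The linear part of \<open>\<psi>\<^sub>n\<close> therefore satisfies a trivial recursion, and
  its monomial \<open>x\<^sub>n\<close> shows that the upper bound \<open>n\<close> is attained.
\<close>

subsection \<open>Weights of monomials\<close>

text \<open>Keeping \<open>w\<close> free lets one additivity proof serve both partition order and
  total degree.\<close>

definition weight :: "(nat \<Rightarrow> nat) \<Rightarrow> (nat \<Rightarrow>\<^sub>0 nat) \<Rightarrow> nat" where
  "weight w m = (\<Sum>i\<in>Poly_Mapping.keys m. w i * Poly_Mapping.lookup m i)"

definition total_degree :: "(nat \<Rightarrow>\<^sub>0 nat) \<Rightarrow> nat" where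
  "total_degree = weight (\<lambda>_. 1)"

lemma partition_order_eq_weight: "partition_order = weight (\<lambda>i. i)"
  by (simp add: fun_eq_iff partition_order_def weight_def)

text \<open>Extra indices have exponent 0. This permits a common index set for monomials with
  different keys.\<close>

lemma weight_superset:
  assumes "finite A" "Poly_Mapping.keys m \<subseteq> A"
  shows "weight w m = (\<Sum>i\<in>A. w i * Poly_Mapping.lookup m i)"
  unfolding weight_def using assms
  by (intro sum.mono_neutral_left) (auto simp: in_keys_iff)

lemma weight_zero [simp]: "weight w 0 = 0"
  by (simp add: weight_def)

lemma weight_add: "weight w (a + b) = weight w a + weight w b"
proof -
  let ?A = "Poly_Mapping.keys a \<union> Poly_Mapping.keys b"
  have "weight w c = (\<Sum>i\<in>?A. w i * Poly_Mapping.lookup c i)" if "c \<in> {a, b, a + b}" for c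
    using that Poly_Mapping.keys_add[of a b] by (intro weight_superset) auto
  then show ?thesis
    by (simp add: lookup_add algebra_simps sum.distrib)
qed

lemma weight_single [simp]: "weight w (Poly_Mapping.single i e) = w i * e"
  by (simp add: weight_def)

lemma partition_order_single [simp]: "partition_order (Poly_Mapping.single i e) = i * e"
  by (simp add: partition_order_eq_weight)

lemma total_degree_single [simp]: "total_degree (Poly_Mapping.single i e) = e"
  by (simp add: total_degree_def)

subsection \<open>Polynomials supported on a graded family of monomials\<close>

lemma keys_X: "Poly_Mapping.keys (X i) = {Poly_Mapping.single i 1}"
  by (simp add: X_def)

lemma keys_of_int_subset: "Poly_Mapping.keys (of_int c :: mpoly_int) \<subseteq> {0}"
proof -
  have "(of_int c :: mpoly_int) = Poly_Mapping.single 0 c"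
    by (metis Poly_Mapping.single_of_int of_int_eq_id id_apply)
  then show ?thesis
    by simp
qed

text \<open>The sets \<open>S d\<close> need not be disjoint: one closure argument covers both an
  upper bound (order at most \<open>d\<close>) and a lower bound (degree at least
  \<open>d\<close>).\<close>

locale graded_family =
  fixes S :: "nat \<Rightarrow> (nat \<Rightarrow>\<^sub>0 nat) set"
  assumes zero_mem: "0 \<in> S 0"
    and add_mem: "a \<in> S d \<Longrightarrow> b \<in> S e \<Longrightarrow> a + b \<in> S (d + e)"
begin

definition F :: "nat \<Rightarrow> mpoly_int \<Rightarrow> bool" where
  "F d f \<longleftrightarrow> Poly_Mapping.keys f \<subseteq> S d"

lemma F_zero: "F d 0"
  by (simp add: F_def)

lemma F_add: "F d f \<Longrightarrow> F d g \<Longrightarrow> F d (f + g)"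
  unfolding F_def using Poly_Mapping.keys_add[of f g] by blast

lemma F_sum: "(\<And>i. i \<in> A \<Longrightarrow> F d (f i)) \<Longrightarrow> F d (\<Sum>i\<in>A. f i)"
  by (induction A rule: infinite_finite_induct) (auto intro: F_add F_zero)

lemma F_mult: "F d f \<Longrightarrow> F e g \<Longrightarrow> F (d + e) (f * g)"
  unfolding F_def using keys_mult[of f g] add_mem by blast

lemma F_of_int: "F 0 (of_int c)"
  unfolding F_def using keys_of_int_subset zero_mem by blast

lemma F_of_int_mult: "F d f \<Longrightarrow> F d (of_int c * f)"
  using F_mult[OF F_of_int, of d f c] by simp

lemma F_of_nat_mult: "F d f \<Longrightarrow> F d (of_nat c * f)"
  using F_of_int_mult[of d f "int c"] by simp

lemma F_uminus: "F d f \<Longrightarrow> F d (- f)"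
  by (simp add: F_def)

lemma F_minus_one_power_mult: "F d f \<Longrightarrow> F d ((-1) ^ c * f)"
  using F_of_int_mult[of d f "(-1) ^ c"] by simp

lemma F_one: "F 0 1"
  using F_of_int[of 1] by simp

lemma F_power: "F d f \<Longrightarrow> F (d * e) (f ^ e)"
  by (induction e) (auto intro: F_one F_mult)

lemma F_prod:
  assumes "finite A" "\<And>i. i \<in> A \<Longrightarrow> F (e i) (f i)"
  shows "F (\<Sum>i\<in>A. e i) (\<Prod>i\<in>A. f i)"
  using assms by (induction A rule: finite_induct) (auto intro: F_one F_mult)

text \<open>If \<open>y i\<close> has level \<open>e i\<close>, the term of index \<open>j\<close>
  has level \<open>\<Sum>i. e i * j i\<close>. The two constraints in \<open>bell_index\<close> make
  this \<open>N\<close> for \<open>e i = i\<close> and \<open>k\<close> for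
  \<open>e i = 1\<close>.\<close>

lemma F_bell_partial:
  assumes "\<And>i. 1 \<le> i \<Longrightarrow> i \<le> N - k + 1 \<Longrightarrow> F (e i) (y i)"
    and "\<And>j. j \<in> bell_index N k \<Longrightarrow> (\<Sum>i=1..N - k + 1. e i * j i) = d"
  shows "F d (bell_partial N k y)"
  unfolding bell_partial_def
proof (intro F_sum F_of_nat_mult)
  fix j assume "j \<in> bell_index N k"
  moreover have "F (\<Sum>i=1..N - k + 1. e i * j i) (\<Prod>i=1..N - k + 1. y i ^ j i)"
    using assms(1) by (intro F_prod F_power) auto
  ultimately show "F d (\<Prod>i=1..N - k + 1. y i ^ j i)"
    using assms(2) by simp
qed

text \<open>All other factors are integers, and the range of \<open>k\<close> gives
  \<open>\<nu> \<le> n - k\<close>.\<close>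

lemma F_Psi_sum:
  assumes "\<And>\<nu> k. 2 \<le> \<nu> \<Longrightarrow> \<nu> \<le> n - k \<Longrightarrow> F d (bell_partial (n - k) \<nu> y)"
  shows "F d (Psi_sum y n)"
  unfolding Psi_sum_def mult.assoc
  by (intro F_sum F_minus_one_power_mult F_of_int_mult F_of_nat_mult assms) auto

end

interpretation le: graded_family "\<lambda>d. {m. partition_order m \<le> d}"
  by unfold_locales (auto simp: partition_order_eq_weight weight_add)

interpretation ge: graded_family "\<lambda>d. {m. d \<le> total_degree m}"
  by unfold_locales (auto simp: total_degree_def weight_add)

text \<open>The zero polynomial is no exception, thanks to the convention
  \<open>pnorm 0 = 0\<close>.\<close>

lemma pnorm_le_iff: "pnorm f \<le> d \<longleftrightarrow> le.F d f"
  by (auto simp: pnorm_def le.F_def)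

lemma le_F_mono: "le.F d f \<Longrightarrow> d \<le> e \<Longrightarrow> le.F e f"
  by (auto simp: le.F_def)

lemma ge_F_antimono: "ge.F e f \<Longrightarrow> d \<le> e \<Longrightarrow> ge.F d f"
  by (auto simp: ge.F_def)

lemma le_F_X: "le.F i (X i)"
  by (simp add: le.F_def keys_X)

lemma ge_F_X: "ge.F 1 (X i)"
  by (simp add: ge.F_def keys_X)

lemma le_pnorm:
  assumes "Poly_Mapping.lookup f m \<noteq> 0"
  shows "partition_order m \<le> pnorm f"
  using assms by (auto simp: pnorm_def in_keys_iff)

lemma ge_F_lookup_linear:
  assumes "ge.F 2 f"
  shows "Poly_Mapping.lookup f (Poly_Mapping.single i 1) = 0"
proof (rule ccontr)
  assume "Poly_Mapping.lookup f (Poly_Mapping.single i 1) \<noteq> 0"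
  then have "2 \<le> total_degree (Poly_Mapping.single i 1)"
    using assms unfolding ge.F_def by (auto simp: in_keys_iff)
  then show False
    by simp
qed

lemma lookup_of_int_mult:
  "Poly_Mapping.lookup (of_int c * (f :: mpoly_int)) m = c * Poly_Mapping.lookup f m"
proof -
  have "of_int c * f = Poly_Mapping.map ((*) c) f"
    by (metis Poly_Mapping.single_of_int of_int_eq_id id_apply mult_map_scale_conv_mult)
  then show ?thesis
    by (simp add: Poly_Mapping.map.rep_eq when_def)
qed

lemma lookup_of_nat_mult:
  "Poly_Mapping.lookup (of_nat c * (f :: mpoly_int)) m = int c * Poly_Mapping.lookup f m"
  using lookup_of_int_mult[of "int c" f m] by simp

subsection \<open>Bell polynomials\<close>

lemma le_F_bell_partial:
  assumes "\<And>i. 1 \<le> i \<Longrightarrow> i \<le> N - k + 1 \<Longrightarrow> le.F i (y i)"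
  shows "le.F N (bell_partial N k y)"
  by (rule le.F_bell_partial[where e = "\<lambda>i. i"]) (use assms in \<open>auto simp: bell_index_def\<close>)

lemma ge_F_bell_partial:
  assumes "\<And>i. 1 \<le> i \<Longrightarrow> i \<le> N - k + 1 \<Longrightarrow> ge.F 1 (y i)"
  shows "ge.F k (bell_partial N k y)"
  by (rule ge.F_bell_partial[where e = "\<lambda>_. 1"]) (use assms in \<open>auto simp: bell_index_def\<close>)

lemma bell_partial_one:
  assumes "n \<ge> 1"
  shows "bell_partial n 1 y = y n"
proof -
  \<comment> \<open>The unit vector at \<open>n\<close>: total 1 forces a unit vector at some
    \<open>a\<close>, and weighted total \<open>n\<close> forces \<open>a = n\<close>.\<close>
  define \<delta> :: "nat \<Rightarrow> nat" where "\<delta> = (\<lambda>i. if i = n then 1 else 0)"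
  have "j = \<delta>" if j: "j \<in> bell_index n 1" for j
  proof -
    have s: "(\<Sum>i=1..n. j i) = 1" "(\<Sum>i=1..n. i * j i) = n" "\<And>i. i \<notin> {1..n} \<Longrightarrow> j i = 0"
      using j assms by (auto simp: bell_index_def)
    from s(1) obtain a where a: "a \<in> {1..n}" "j a = 1" "\<And>b. b \<in> {1..n} \<Longrightarrow> b \<noteq> a \<Longrightarrow> j b = 0"
      using sum_eq_1_iff[of "{1..n}" j] by auto
    have "(\<Sum>i=1..n. i * j i) = (\<Sum>i=1..n. if i = a then a else 0)"
      using a by (intro sum.cong) auto
    then have "a = n"
      using s(2) a(1) by simp
    then show ?thesis
      using a s(3) unfolding \<delta>_def by (intro ext) (metis (full_types))
  qed
  moreover have "\<delta> \<in> bell_index n 1"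
    using assms by (auto simp: bell_index_def \<delta>_def if_distrib[of "\<lambda>t. _ * t"] cong: if_cong)
  ultimately have index: "bell_index n 1 = {\<delta>}"
    by blast
  have "(\<Prod>i=1..n. fact (\<delta> i) * fact i ^ \<delta> i) = (\<Prod>i=1..n. if i = n then fact n else 1 :: nat)"
    by (intro prod.cong) (auto simp: \<delta>_def)
  then have f: "(\<Prod>i=1..n. fact (\<delta> i) * fact i ^ \<delta> i) = (fact n :: nat)"
    using assms by simp
  have "(\<Prod>i=1..n. y i ^ \<delta> i) = (\<Prod>i=1..n. if i = n then y n else 1)"
    by (intro prod.cong) (auto simp: \<delta>_def)
  then have y: "(\<Prod>i=1..n. y i ^ \<delta> i) = y n"
    using assms by simp
  show ?thesis
    unfolding bell_partial_def index le_add_diff_inverse2[OF assms] using f y by simp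
qed

lemma bell_partial_self: "bell_partial n n y = y 1 ^ n"
proof -
  have "bell_index n n = {\<lambda>i. if i = 1 then n else 0}"
    by (auto simp: bell_index_def fun_eq_iff)
  then show ?thesis
    by (simp add: bell_partial_def)
qed

section \<open>Order and linear part of \<open>sigma_star\<close>\<close>

lemma le_F_sigma_star: "le.F n (sigma_star n)"
  unfolding sigma_star_def bell_complete_def
  by (intro le.F_minus_one_power_mult le.F_sum le_F_bell_partial le.F_uminus le.F_of_nat_mult le_F_X)

text \<open>The linear monomial is the summand \<open>k = 1\<close> of the complete Bell polynomial;
  \<open>g\<close> collects those with \<open>k \<ge> 2\<close>.\<close>

lemma sigma_star_decomp:
  assumes "n \<ge> 1"
  obtains g where "ge.F 2 g" "sigma_star n = of_int ((-1) ^ (n - 1) * fact (n - 1)) * X n + g"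
proof
  let ?y = "\<lambda>i. - (of_nat (fact (i - 1)) * X i)"
  let ?g = "(-1) ^ n * (\<Sum>k=2..n. bell_partial n k ?y)"
  show "ge.F 2 ?g"
  proof (intro ge.F_minus_one_power_mult ge.F_sum)
    fix k assume "k \<in> {2..n}"
    moreover have "ge.F k (bell_partial n k ?y)"
      by (intro ge_F_bell_partial ge.F_uminus ge.F_of_nat_mult ge_F_X)
    ultimately show "ge.F 2 (bell_partial n k ?y)"
      by (auto intro: ge_F_antimono)
  qed
  have "bell_complete n ?y = ?y n + (\<Sum>k=2..n. bell_partial n k ?y)"
    unfolding bell_complete_def
    using assms by (subst sum.atLeast_Suc_atMost) (simp_all add: bell_partial_one[simplified] numeral_2_eq_2)
  \<comment> \<open>The minus sign in \<open>?y n\<close> turns \<open>(-1) ^ n\<close> into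
    \<open>(-1) ^ (n - 1)\<close>.\<close>
  moreover have "(-1) ^ n * (?y n + h) =
      of_int ((-1) ^ (n - 1) * fact (n - 1)) * X n + (-1) ^ n * h" for h
    using assms by (cases n) (simp_all add: algebra_simps)
  ultimately show "sigma_star n = of_int ((-1) ^ (n - 1) * fact (n - 1)) * X n + ?g"
    unfolding sigma_star_def by (simp only:)
qed

lemma ge_F_sigma_star:
  assumes "n \<ge> 1"
  shows "ge.F 1 (sigma_star n)"
  by (rule sigma_star_decomp[OF assms])
    (auto simp only: intro!: ge.F_add ge.F_of_int_mult ge_F_X elim: ge_F_antimono)

subsection \<open>The polynomials \<open>\<psi>\<close>\<close>

text \<open>Since \<open>\<nu> \<ge> 2\<close>, the arguments have index at most
  \<open>n - k - \<nu> + 1 < n\<close>, so the hypothesis matches a strong induction on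
  \<open>n\<close>.\<close>

lemma le_F_Psi_sum:
  assumes "\<And>i. 1 \<le> i \<Longrightarrow> i < n \<Longrightarrow> le.F i (y i)"
  shows "le.F n (Psi_sum y n)"
proof (rule le.F_Psi_sum)
  fix \<nu> k assume "2 \<le> \<nu>" "\<nu> \<le> n - k"
  then have "le.F (n - k) (bell_partial (n - k) \<nu> y)"
    by (intro le_F_bell_partial assms) auto
  then show "le.F n (bell_partial (n - k) \<nu> y)"
    by (rule le_F_mono) simp
qed

lemma ge_F_Psi_sum:
  assumes "\<And>i. 1 \<le> i \<Longrightarrow> i < n \<Longrightarrow> ge.F 1 (y i)"
  shows "ge.F 2 (Psi_sum y n)"
proof (rule ge.F_Psi_sum)
  fix \<nu> k assume *: "2 \<le> \<nu>" "\<nu> \<le> n - k"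
  then have "ge.F \<nu> (bell_partial (n - k) \<nu> y)"
    by (intro ge_F_bell_partial assms) auto
  then show "ge.F 2 (bell_partial (n - k) \<nu> y)"
    using * by (auto intro: ge_F_antimono)
qed

lemma le_F_psi: "le.F n (psi n)"
proof (induction n rule: less_induct)
  case (less n)
  show ?case
  proof (cases n)
    case 0
    then show ?thesis by (simp add: le.F_zero)
  next
    case (Suc m)
    have "le.F n (psi m)"
      using less[of m] Suc by (auto intro: le_F_mono)
    then show ?thesis
      unfolding Suc psi.simps using less Suc
      by (intro le.F_add le.F_of_nat_mult le_F_sigma_star le_F_Psi_sum) auto
  qed
qed

text \<open>The absence of constant terms is what puts \<open>Psi n\<close> into
  \<open>ge.F 2\<close>.\<close>

lemma ge_F_psi: "ge.F 1 (psi n)"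
proof (induction n rule: less_induct)
  case (less n)
  show ?case
  proof (cases n)
    case 0
    then show ?thesis by (simp add: ge.F_zero)
  next
    case (Suc m)
    have "ge.F 1 (Psi_sum psi (Suc m))"
      using less Suc by (intro ge_F_antimono[OF ge_F_Psi_sum]) auto
    then show ?thesis
      unfolding Suc psi.simps using less Suc
      by (intro ge.F_add ge.F_of_nat_mult ge_F_sigma_star) auto
  qed
qed

text \<open>In \<open>psi_rec\<close>, both \<open>Psi n\<close> and the remainder \<open>g\<close>
  of \<open>sigma_star n\<close> lie in \<open>ge.F 2\<close>, so neither contributes to a linear
  coefficient.\<close>

lemma lookup_psi_linear:
  assumes "n \<ge> 1"
  shows "Poly_Mapping.lookup (psi n) (Poly_Mapping.single i 1) =
    int n * Poly_Mapping.lookup (psi (n - 1)) (Poly_Mapping.single i 1) +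
    (if i = n then (-1) ^ (n - 1) * fact (n - 1) else 0)"
proof -
  obtain g where g: "ge.F 2 g" "sigma_star n = of_int ((-1) ^ (n - 1) * fact (n - 1)) * X n + g"
    using sigma_star_decomp[OF assms] .
  have "ge.F 2 (Psi n)"
    unfolding Psi_def by (intro ge_F_Psi_sum ge_F_psi)
  moreover have "Poly_Mapping.lookup (X n) (Poly_Mapping.single i 1) = (if i = n then 1 else 0)"
    \<comment> \<open>Equal monomials have equal key sets, which yields
      \<open>i = n\<close>.\<close>
    by (auto simp: X_def lookup_single when_def dest: arg_cong[of _ _ Poly_Mapping.keys])
  ultimately show ?thesis
    unfolding psi_rec[OF assms] g(2) lookup_add lookup_of_int_mult lookup_of_nat_mult
    using g(1) by (simp only: ge_F_lookup_linear) simp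
qed

lemma lookup_psi_beyond:
  assumes "n < i"
  shows "Poly_Mapping.lookup (psi n) (Poly_Mapping.single i 1) = 0"
proof (rule ccontr)
  assume "Poly_Mapping.lookup (psi n) (Poly_Mapping.single i 1) \<noteq> 0"
  then have "partition_order (Poly_Mapping.single i 1) \<le> n"
    using le_F_psi[of n] unfolding le.F_def by (auto simp: in_keys_iff)
  then show False
    using assms by simp
qed

text \<open>The order bound on \<open>psi (n - 1)\<close> excludes the variable of index
  \<open>n\<close>, so only the \<open>sigma_star\<close> term remains.\<close>

lemma lookup_psi_top:
  assumes "n \<ge> 1"
  shows "Poly_Mapping.lookup (psi n) (Poly_Mapping.single n 1) = (-1) ^ (n - 1) * fact (n - 1)"
  using lookup_psi_linear[OF assms, of n] lookup_psi_beyond[of "n - 1" n] assms by simp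

text \<open>For \<open>n \<ge> 2\<close> the linear recursion is just multiplication by
  \<open>n\<close>; the start value 1 is the top coefficient of \<open>psi 1\<close>.\<close>

lemma lookup_psi_X1:
  assumes "n \<ge> 1"
  shows "Poly_Mapping.lookup (psi n) (Poly_Mapping.single 1 1) = fact n"
  using assms
proof (induction n rule: dec_induct)
  case base
  show ?case using lookup_psi_top[of 1] by simp
next
  case (step n)
  then show ?case using lookup_psi_linear[of "Suc n" 1] by simp
qed

lemma pnorm_psi:
  assumes "n \<ge> 1"
  shows "pnorm (psi n) = n"
proof (rule antisym)
  show "pnorm (psi n) \<le> n"
    by (simp add: pnorm_le_iff le_F_psi)
  show "n \<le> pnorm (psi n)"
    using le_pnorm[of "psi n" "Poly_Mapping.single n 1"] lookup_psi_top[OF assms]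
    by simp
qed

text \<open>The sum over \<open>\<nu>\<close> is empty for \<open>n = 1\<close>, and two signs
  cancel in \<open>sigma_star 1\<close>.\<close>

lemma psi_1: "psi 1 = X 1"
  by (simp add: Psi_sum_def sigma_star_def bell_complete_def bell_partial_self)

lemma X_power: "X i ^ n = Poly_Mapping.single (Poly_Mapping.single i n) 1"
  by (induction n) (simp_all add: X_def Poly_Mapping.mult_single flip: Poly_Mapping.single_add)

lemma pnorm_X_power: "pnorm (X i ^ n) = i * n"
  by (simp add: X_power pnorm_def)

theorem theorem4p3:
  fixes n :: nat
  assumes "n \<ge> 1"
  shows "pnorm (psi n) = n \<and> pnorm (Psi n) \<le> n \<and>
    (\<forall>k. 1 \<le> k \<and> k \<le> n \<longrightarrow> pnorm (bell_partial n k psi) \<le> n) \<and>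
    bell_partial n n psi = X 1 ^ n \<and> pnorm (bell_partial n n psi) = n \<and>
    (n \<ge> 2 \<longrightarrow>
      Poly_Mapping.lookup (psi n) (Poly_Mapping.single 1 1) = fact n \<and>
      Poly_Mapping.lookup (psi n) (Poly_Mapping.single n 1) = (-1) ^ (n - 1) * fact (n - 1))"
proof -
  have "pnorm (Psi n) \<le> n"
    unfolding pnorm_le_iff Psi_def by (intro le_F_Psi_sum le_F_psi)
  moreover have "pnorm (bell_partial n k psi) \<le> n" for k
    unfolding pnorm_le_iff by (intro le_F_bell_partial le_F_psi)
  moreover have "bell_partial n n psi = X 1 ^ n"
    by (simp only: bell_partial_self psi_1)
  ultimately show ?thesis
    using pnorm_psi[OF assms] lookup_psi_X1[OF assms] lookup_psi_top[OF assms]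
    by (simp add: pnorm_X_power)
qed

end
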